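(* Let $q_0,q_1:\mathbb{R}^n\to\mathbb{R}$ be quadratic functions $q_i(x)=x^\top A_i x+2b_i^\top x+c_i$ with $A_i\in\mathbb{R}^{n\times n}$ symmetric, $b_i\in\mathbb{R}^n$, $c_i\in\mathbb{R}$, and suppose there exists $\gamma^*\geq 0$ with $A_0+\gamma^*A_1\succeq 0$. Consider the closed nonempty interval $\Gamma:=\{\gamma\geq 0: A_0+\gamma A_1\succeq 0\}$ and let $\gamma_-$ be its leftmost endpoint. (1) If $\Gamma$ is bounded above, let $\gamma_+$ be its rightmost endpoint. Then $\overline{\operatorname{conv}}(\mathcal{S})=\mathcal{S}(\gamma_-)\cap\mathcal{S}(\gamma_+)$, and $\inf_{x\in\mathbb{R}^n}\{q_0(x): q_1(x)\leq 0\}=\inf_{x\in\mathbb{R}^n}\max\{q(\gamma_-,x),q(\gamma_+,x)\}$. (2) If $\Gamma$ is not bounded above, then $q_1$ is convex, $\overline{\operatorname{conv}}(\mathcal{S})=\mathcal{S}(\gamma_-)\cap\{(x,t)\in\mathbb{R}^{n+1}: q_1(x)\leq 0\}$, and $\inf_{x\in\mathbb{R}^n}\{q_0(x): q_1(x)\leq 0\}=\inf_{x\in\mathbb{R}^n}\{q(\gamma_-,x): q_1(x)\leq 0\}$.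
   Context: For $\gamma\in\mathbb{R}$, $q(\gamma,x):=q_0(x)+\gamma q_1(x)$. $\mathcal{S}:=\{(x,t)\in\mathbb{R}^{n+1}: q_0(x)\leq t,\ q_1(x)\leq 0\}$ and for $\gamma\geq 0$, $\mathcal{S}(\gamma):=\{(x,t)\in\mathbb{R}^{n+1}: q(\gamma,x)\leq t\}$. $\overline{\operatorname{conv}}$ denotes closed convex hull. *)

theory Defs
  imports "HOL-Analysis.Analysis"
begin

definition quad_fun :: "real^'n^'n \<Rightarrow> real^'n \<Rightarrow> real \<Rightarrow> real^'n \<Rightarrow> real" where
  "quad_fun A b c x = x \<bullet> (A *v x) + 2 * (b \<bullet> x) + c"

definition psd :: "real^'n^'n \<Rightarrow> bool" where
  "psd A \<longleftrightarrow> transpose A = A \<and> (\<forall>x. 0 \<le> x \<bullet> (A *v x))"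

definition psd_multipliers :: "real^'n^'n \<Rightarrow> real^'n^'n \<Rightarrow> real set" where
  "psd_multipliers A0 A1 = {\<gamma>. 0 \<le> \<gamma> \<and> psd (A0 + \<gamma> *\<^sub>R A1)}"

definition aggregate :: "('a \<Rightarrow> real) \<Rightarrow> ('a \<Rightarrow> real) \<Rightarrow> real \<Rightarrow> 'a \<Rightarrow> real" where
  "aggregate q0 q1 \<gamma> x = q0 x + \<gamma> * q1 x"

text \<open>The sets live in \<open>'a \<times> real\<close>, which for \<open>'a = real^'n\<close> plays the role of
  the space of dimension \<open>n + 1\<close>.\<close>

definition constrained_epigraph :: "('a \<Rightarrow> real) \<Rightarrow> ('a \<Rightarrow> real) \<Rightarrow> ('a \<times> real) set" where
  "constrained_epigraph q0 q1 = {(x, t). q0 x \<le> t \<and> q1 x \<le> 0}"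

definition aggregate_epigraph ::
    "('a \<Rightarrow> real) \<Rightarrow> ('a \<Rightarrow> real) \<Rightarrow> real \<Rightarrow> ('a \<times> real) set" where
  "aggregate_epigraph q0 q1 \<gamma> = {(x, t). aggregate q0 q1 \<gamma> x \<le> t}"

end

theory Submission
  imports Defs
begin

text \<open>
  Fix an endpoint \<open>\<mu>\<close> of \<open>\<Gamma>\<close> and a point \<open>x\<close> with \<open>q1 x \<noteq> 0\<close> that violates
  \<open>S\<close> although \<open>q(\<mu>,x) \<le> t\<close>. Just outside \<open>\<Gamma>\<close>, at \<open>\<gamma>\<close> near \<open>\<mu>\<close>, the matrix
  \<open>A0 + \<gamma> A1\<close> has a direction \<open>v\<close> of negative curvature. Along \<open>x + s v\<close> the function
  \<open>q1\<close> has two roots on either side of \<open>s = 0\<close>, and at these roots \<open>q0 = q(\<mu>,\<cdot>)\<close>.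
  Writing \<open>x\<close> as the convex combination of the two roots raises the averaged value of \<open>q(\<mu>,\<cdot>)\<close>
  above \<open>q(\<mu>,x)\<close> by exactly \<open>- q1 x * (v \<bullet> (A0 + \<mu> A1) v) / (v \<bullet> A1 v)\<close>, which is at most
  \<open>\<bar>q1 x\<bar> * \<bar>\<gamma> - \<mu>\<bar>\<close>. Letting \<open>\<gamma>\<close> tend to \<open>\<mu>\<close> puts \<open>(x, t)\<close> in the closed convex hull;
  no attained kernel direction is needed.
\<close>

section \<open>Quadratic functions under aggregation and along lines\<close>

lemma matrix_vector_mult_add_scaleR:
  fixes A B :: "real^'n^'m"
  shows "(A + g *\<^sub>R B) *v x = A *v x + g *\<^sub>R (B *v x)"
  by (simp add: matrix_vector_mult_add_rdistrib scaleR_matrix_vector_assoc)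

lemma quadratic_form_add_scaleR:
  fixes A B :: "real^'n^'n"
  shows "x \<bullet> ((A + g *\<^sub>R B) *v x) = x \<bullet> (A *v x) + g * (x \<bullet> (B *v x))"
  by (simp add: matrix_vector_mult_add_scaleR inner_add_right)

lemma transpose_add_scaleR:
  fixes A B :: "real^'n^'n"
  assumes "transpose A = A" "transpose B = B"
  shows "transpose (A + g *\<^sub>R B) = A + g *\<^sub>R B"
  using assms by (simp add: transpose_def vec_eq_iff)

lemma aggregate_quad_fun:
  "aggregate (quad_fun A0 b0 c0) (quad_fun A1 b1 c1) g
     = quad_fun (A0 + g *\<^sub>R A1) (b0 + g *\<^sub>R b1) (c0 + g * c1)"
  by (rule ext)
    (simp add: aggregate_def quad_fun_def quadratic_form_add_scaleR inner_add_left distrib_left distrib_right)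

text \<open>Symmetry of \<open>A\<close> merges the two cross terms. The leading coefficient in
  \<open>s\<close> is the curvature in direction \<open>v\<close>, so the hull construction becomes
  a one-variable problem.\<close>

lemma quad_fun_line:
  fixes A :: "real^'n^'n"
  assumes "transpose A = A"
  shows "quad_fun A b c (x + s *\<^sub>R v)
    = quad_fun A b c x + s * (2 * (v \<bullet> (A *v x)) + 2 * (b \<bullet> v)) + s\<^sup>2 * (v \<bullet> (A *v v))"
proof -
  have "x \<bullet> (A *v v) = v \<bullet> (A *v x)"
    using dot_lmul_matrix[of x A v] assms
    by (metis inner_commute transpose_matrix_vector)
  then show ?thesis
    by (simp add: quad_fun_def matrix_vector_right_distrib matrix_vector_mult_scaleR
        inner_add_left inner_add_right power2_eq_square algebra_simps)
qed

lemma continuous_on_quad_fun [continuous_intros]: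
  fixes f :: "'a::topological_space \<Rightarrow> real^'n"
  assumes "continuous_on S f"
  shows "continuous_on S (\<lambda>x. quad_fun A b c (f x))"
  unfolding quad_fun_def
  by (intro continuous_intros assms bounded_linear.continuous_on[OF matrix_vector_mul_bounded_linear])

text \<open>On a segment the function is a quadratic in \<open>t\<close> with leading coefficient
  \<open>P\<close>, which is nonnegative; since \<open>t\<^sup>2 \<le> t\<close>, it stays below the
  chord.\<close>

lemma convex_on_quad_fun:
  fixes A :: "real^'n^'n"
  assumes "psd A"
  shows "convex_on UNIV (quad_fun A b c)"
proof (rule convex_onI)
  fix t :: real and x y :: "real^'n"
  assume t: "0 < t" "t < 1"
  have sym: "transpose A = A" and nonneg: "0 \<le> (y - x) \<bullet> (A *v (y - x))"
    using assms by (auto simp: psd_def)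
  define B where "B = 2 * ((y - x) \<bullet> (A *v x)) + 2 * (b \<bullet> (y - x))"
  define P where "P = (y - x) \<bullet> (A *v (y - x))"
  have line: "quad_fun A b c (x + s *\<^sub>R (y - x)) = quad_fun A b c x + s * B + s\<^sup>2 * P" for s
    unfolding B_def P_def by (rule quad_fun_line[OF sym])
  have "(1 - t) *\<^sub>R x + t *\<^sub>R y = x + t *\<^sub>R (y - x)"
    by (simp add: algebra_simps)
  then have "quad_fun A b c ((1 - t) *\<^sub>R x + t *\<^sub>R y) = quad_fun A b c x + t * B + t\<^sup>2 * P"
    using line by simp
  also have "t\<^sup>2 * P \<le> t * P"
    using t nonneg by (intro mult_right_mono) (auto simp: P_def power2_eq_square)
  also have "quad_fun A b c x + t * B + t * P
      = (1 - t) * quad_fun A b c x + t * quad_fun A b c y"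
    using line[of 1] by (simp add: algebra_simps)
  finally show "quad_fun A b c ((1 - t) *\<^sub>R x + t *\<^sub>R y)
      \<le> (1 - t) * quad_fun A b c x + t * quad_fun A b c y" by simp
qed simp

section \<open>Closed convex supersets of the constrained epigraph\<close>

lemma closed_aggregate_epigraph:
  "closed (aggregate_epigraph (quad_fun A0 b0 c0) (quad_fun A1 b1 c1) g)"
proof -
  have "aggregate_epigraph (quad_fun A0 b0 c0) (quad_fun A1 b1 c1) g
      = {p. aggregate (quad_fun A0 b0 c0) (quad_fun A1 b1 c1) g (fst p) \<le> snd p}"
    by (auto simp: aggregate_epigraph_def)
  then show ?thesis
    unfolding aggregate_quad_fun by (auto intro!: closed_Collect_le continuous_intros)
qed

lemma convex_aggregate_epigraph:
  assumes "psd (A0 + g *\<^sub>R A1)"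
  shows "convex (aggregate_epigraph (quad_fun A0 b0 c0) (quad_fun A1 b1 c1) g)"
proof -
  have "aggregate_epigraph (quad_fun A0 b0 c0) (quad_fun A1 b1 c1) g
      = epigraph UNIV (aggregate (quad_fun A0 b0 c0) (quad_fun A1 b1 c1) g)"
    by (auto simp: aggregate_epigraph_def epigraph_def)
  then show ?thesis
    unfolding aggregate_quad_fun using convex_on_quad_fun[OF assms] by (simp add: convex_epigraph)
qed

lemma constrained_epigraph_subset_aggregate_epigraph:
  assumes "0 \<le> g"
  shows "constrained_epigraph q0 q1 \<subseteq> aggregate_epigraph q0 q1 g"
  using mult_nonneg_nonpos[OF assms]
  by (fastforce simp: constrained_epigraph_def aggregate_epigraph_def aggregate_def)

lemma closure_hull_constrained_epigraph_subset:
  assumes "0 \<le> g" "psd (A0 + g *\<^sub>R A1)"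
  shows "closure (convex hull (constrained_epigraph (quad_fun A0 b0 c0) (quad_fun A1 b1 c1)))
    \<subseteq> aggregate_epigraph (quad_fun A0 b0 c0) (quad_fun A1 b1 c1) g"
  using assms
  by (intro closure_minimal hull_minimal constrained_epigraph_subset_aggregate_epigraph
      closed_aggregate_epigraph convex_aggregate_epigraph)

text \<open>The set \<open>?H\<close> is closed, convex and contains the constrained epigraph, so
  the lower bound on heights survives passage to the hull. With \<open>ereal\<close> values this
  covers an objective unbounded below (\<open>?H\<close> is everything) and an infeasible constraint
  (\<open>?H\<close> is empty).\<close>

lemma INF_le_closure_hull_constrained_epigraph:
  assumes "(x, t) \<in> closure (convex hull (constrained_epigraph q0 q1))"
  shows "(INF x\<in>{x. q1 x \<le> 0}. ereal (q0 x)) \<le> ereal t" (is "?L \<le> _")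
proof -
  let ?H = "{p :: 'a \<times> real. ?L \<le> ereal (snd p)}"
  have "?H = UNIV \<times> {r..}" if "?L = ereal r" for r
    using that by auto
  then have "closed ?H \<and> convex ?H"
    by (cases ?L) (auto simp: closed_Times convex_Times)
  moreover have "constrained_epigraph q0 q1 \<subseteq> ?H"
    by (auto simp: constrained_epigraph_def intro!: INF_lower2)
  ultimately have "closure (convex hull (constrained_epigraph q0 q1)) \<subseteq> ?H"
    by (intro closure_minimal hull_minimal) auto
  then show ?thesis using assms by auto
qed

section \<open>Two-point decomposition along a direction\<close>

text \<open>Since \<open>a * d < 0\<close>, the discriminant exceeds \<open>b\<^sup>2\<close>; its
  square root \<open>D\<close> then dominates \<open>\<bar>b\<bar>\<close>, and the quadratic
  formula gives one root of each sign.\<close>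

lemma quadratic_opposite_roots:
  fixes a b d :: real
  assumes "a * d < 0"
  obtains s1 s2 where "s1 < 0" "0 < s2" "a * s1\<^sup>2 + b * s1 + d = 0" "a * s2\<^sup>2 + b * s2 + d = 0"
    "s1 * s2 = d / a"
proof -
  have a: "a \<noteq> 0" using assms by auto
  have disc: "b\<^sup>2 < b\<^sup>2 - 4 * a * d" using assms by simp
  define D where "D = sqrt (b\<^sup>2 - 4 * a * d)"
  have D2: "D\<^sup>2 = b\<^sup>2 - 4 * a * d"
    unfolding D_def using disc by (intro real_sqrt_pow2) (smt (verit) zero_le_power2)
  have D: "\<bar>b\<bar> < D"
    unfolding D_def using disc by (metis real_sqrt_abs real_sqrt_less_iff)
  define r1 r2 where "r1 = (- b - D) / (2 * a)" and "r2 = (- b + D) / (2 * a)"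
  have root: "a * r\<^sup>2 + b * r + d = 0" if "r = r1 \<or> r = r2" for r
  proof -
    have "(2 * a * r + b)\<^sup>2 = D\<^sup>2"
      using that a by (auto simp: r1_def r2_def)
    then have "4 * a * (a * r\<^sup>2 + b * r + d) = 0"
      unfolding D2 by (simp add: power2_eq_square algebra_simps)
    then show ?thesis using a by simp
  qed
  have prod: "r1 * r2 = d / a"
  proof -
    have "r1 * r2 = (b\<^sup>2 - D\<^sup>2) / (4 * a * a)"
      unfolding r1_def r2_def using a by (simp add: field_simps power2_eq_square)
    also have "\<dots> = d / a"
      unfolding D2 using a by (simp add: field_simps)
    finally show ?thesis .
  qed
  show thesis
  proof (cases "a > 0")
    case True
    then have "r1 < 0" "0 < r2"
      using D by (auto simp: r1_def r2_def divide_less_0_iff zero_less_divide_iff)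
    then show thesis using that root prod by blast
  next
    case False
    then have "r2 < 0" "0 < r1"
      using D a by (auto simp: r1_def r2_def divide_less_0_iff zero_less_divide_iff)
    then show thesis using that root prod by (metis mult.commute)
  qed
qed

lemma mem_hull_constrained_epigraph_line:
  fixes A0 A1 :: "real^'n^'n"
  assumes sym: "transpose A0 = A0" "transpose A1 = A1"
    and q: "q0 = quad_fun A0 b0 c0" "q1 = quad_fun A1 b1 c1"
    and opp: "v \<bullet> (A1 *v v) * q1 x < 0"
    and t: "aggregate q0 q1 m x - q1 x * (v \<bullet> ((A0 + m *\<^sub>R A1) *v v)) / (v \<bullet> (A1 *v v)) \<le> t"
  shows "(x, t) \<in> convex hull (constrained_epigraph q0 q1)"
proof -
  define a where "a = v \<bullet> (A1 *v v)"
  define p where "p = v \<bullet> ((A0 + m *\<^sub>R A1) *v v)"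
  \<comment> \<open>The linear coefficients stay anonymous: \<open>B\<close> enters only through the
    roots, and \<open>C\<close> cancels in the average.\<close>
  obtain B where B: "\<And>s. q1 (x + s *\<^sub>R v) = q1 x + s * B + s\<^sup>2 * a"
    unfolding q a_def using quad_fun_line[OF sym(2)] by blast
  obtain C where C: "\<And>s. aggregate q0 q1 m (x + s *\<^sub>R v) = aggregate q0 q1 m x + s * C + s\<^sup>2 * p"
    unfolding q a_def p_def aggregate_quad_fun
    using quad_fun_line[OF transpose_add_scaleR[OF sym]] by blast
  obtain s1 s2 where s: "s1 < 0" "0 < s2" "s1 * s2 = q1 x / a"
    and r: "a * s1\<^sup>2 + B * s1 + q1 x = 0" "a * s2\<^sup>2 + B * s2 + q1 x = 0"
    using quadratic_opposite_roots[of a "q1 x" B] opp unfolding a_def by blast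
  \<comment> \<open>The slack \<open>d\<close> is added to both points, so that their combination
    has height exactly \<open>t\<close> and not merely the least admissible height.\<close>
  define d where "d = t - (aggregate q0 q1 m x - q1 x * p / a)"
  define y where "y s = (x + s *\<^sub>R v, aggregate q0 q1 m (x + s *\<^sub>R v) + d)" for s
  have "0 \<le> d" using t by (simp add: d_def a_def p_def)
  moreover have "q1 (x + s1 *\<^sub>R v) = 0" "q1 (x + s2 *\<^sub>R v) = 0"
    unfolding B using r by (simp_all add: algebra_simps)
  ultimately have "y s1 \<in> constrained_epigraph q0 q1" "y s2 \<in> constrained_epigraph q0 q1"
    by (simp_all add: y_def constrained_epigraph_def aggregate_def)
  then have mem: "y s1 \<in> convex hull (constrained_epigraph q0 q1)"
    "y s2 \<in> convex hull (constrained_epigraph q0 q1)"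
    by (simp_all add: hull_inc)
  \<comment> \<open>These weights average \<open>s1\<close> and \<open>s2\<close> to 0, hence the
    two points to \<open>x\<close>; the opposite signs make them nonnegative.\<close>
  define l1 l2 where "l1 = s2 / (s2 - s1)" and "l2 = - s1 / (s2 - s1)"
  have l: "0 \<le> l1" "0 \<le> l2" "l1 + l2 = 1" "l1 * s1 + l2 * s2 = 0"
    using s(1,2) by (simp_all add: l1_def l2_def divide_le_0_iff diff_divide_distrib[symmetric])
  \<comment> \<open>The second moment of a mean-zero two-point distribution is minus the product of
    its points, here known from the roots.\<close>
  have sq: "l1 * s1\<^sup>2 + l2 * s2\<^sup>2 = - (q1 x / a)"
  proof -
    have "l1 * s1\<^sup>2 + l2 * s2\<^sup>2 + (l1 + l2) * (s1 * s2) = (s1 + s2) * (l1 * s1 + l2 * s2)"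
      by (simp add: power2_eq_square algebra_simps)
    then show ?thesis using l s(3) by simp
  qed
  have "l1 *\<^sub>R (x + s1 *\<^sub>R v) + l2 *\<^sub>R (x + s2 *\<^sub>R v) = (l1 + l2) *\<^sub>R x + (l1 * s1 + l2 * s2) *\<^sub>R v"
    by (simp add: algebra_simps)
  then have fst: "l1 *\<^sub>R (x + s1 *\<^sub>R v) + l2 *\<^sub>R (x + s2 *\<^sub>R v) = x"
    using l by simp
  have "l1 * (aggregate q0 q1 m (x + s1 *\<^sub>R v) + d) + l2 * (aggregate q0 q1 m (x + s2 *\<^sub>R v) + d)
      = (l1 + l2) * (aggregate q0 q1 m x + d) + (l1 * s1 + l2 * s2) * C
        + (l1 * s1\<^sup>2 + l2 * s2\<^sup>2) * p"
    unfolding C by (simp add: algebra_simps)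
  also have "\<dots> = t"
    unfolding sq l by (simp add: d_def)
  finally have "l1 *\<^sub>R y s1 + l2 *\<^sub>R y s2 = (x, t)"
    using fst by (simp add: y_def)
  then show ?thesis
    using convexD[OF convex_convex_hull mem l(1,2,3)] by simp
qed

text \<open>Each direction from \<open>dir\<close> puts the point into the hull after a lift of
  \<open>t\<close> by \<open>\<bar>q1 x\<bar> * e\<close>, and the lift vanishes with
  \<open>e\<close>. Bounding relative to the curvature of \<open>A1\<close> makes the condition
  invariant under scaling of \<open>v\<close>.\<close>

lemma mem_closure_hull_constrained_epigraph:
  fixes A0 A1 :: "real^'n^'n"
  assumes sym: "transpose A0 = A0" "transpose A1 = A1"
    and q: "q0 = quad_fun A0 b0 c0" "q1 = quad_fun A1 b1 c1"
    and dir: "\<And>e. 0 < e \<Longrightarrow> \<exists>v. v \<bullet> (A1 *v v) * q1 x < 0 \<and>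
      v \<bullet> ((A0 + m *\<^sub>R A1) *v v) \<le> e * \<bar>v \<bullet> (A1 *v v)\<bar>"
    and t: "aggregate q0 q1 m x \<le> t"
  shows "(x, t) \<in> closure (convex hull (constrained_epigraph q0 q1))"
proof (rule closure_sequential[THEN iffD2], intro exI conjI allI)
  define e where "e n = inverse (real (Suc n))" for n
  show "(x, t + \<bar>q1 x\<bar> * e n) \<in> convex hull (constrained_epigraph q0 q1)" for n
  proof -
    have "0 < e n" by (simp add: e_def)
    from dir[OF this] obtain v where opp: "v \<bullet> (A1 *v v) * q1 x < 0"
      and le: "v \<bullet> ((A0 + m *\<^sub>R A1) *v v) \<le> e n * \<bar>v \<bullet> (A1 *v v)\<bar>" by blast
    define a where "a = v \<bullet> (A1 *v v)"
    define p where "p = v \<bullet> ((A0 + m *\<^sub>R A1) *v v)"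
    have a: "a \<noteq> 0" using opp by (auto simp: a_def)
    \<comment> \<open>By \<open>opp\<close>, \<open>q1 x\<close> and \<open>a\<close> have opposite
      signs, so the minus sign disappears into absolute values.\<close>
    have "- (q1 x * p / a) = \<bar>q1 x\<bar> * (p / \<bar>a\<bar>)"
      using opp by (auto simp: a_def[symmetric] mult_less_0_iff abs_if)
    also have "\<dots> \<le> \<bar>q1 x\<bar> * e n"
      using le a by (intro mult_left_mono) (simp_all add: a_def p_def pos_divide_le_eq)
    finally show ?thesis
      using t by (intro mem_hull_constrained_epigraph_line[OF sym q opp, where m = m])
        (simp add: a_def p_def)
  qed
  have "e \<longlonglongrightarrow> 0"
    unfolding e_def by (rule LIMSEQ_inverse_real_of_nat)
  then have "(\<lambda>n. (x, t + \<bar>q1 x\<bar> * e n)) \<longlonglongrightarrow> (x, t + \<bar>q1 x\<bar> * 0)"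
    by (intro tendsto_intros)
  then show "(\<lambda>n. (x, t + \<bar>q1 x\<bar> * e n)) \<longlonglongrightarrow> (x, t)" by simp
qed

section \<open>The interval of multipliers\<close>

text \<open>Each \<open>v\<close> contributes one inequality affine in \<open>g\<close>; closedness,
  the interval property and the unbounded case are read off from this family.\<close>

lemma psd_multipliers_iff:
  assumes "transpose A0 = A0" "transpose A1 = A1"
  shows "g \<in> psd_multipliers A0 A1
    \<longleftrightarrow> 0 \<le> g \<and> (\<forall>v. 0 \<le> v \<bullet> (A0 *v v) + g * (v \<bullet> (A1 *v v)))"
  using transpose_add_scaleR[OF assms]
  by (simp add: psd_multipliers_def psd_def quadratic_form_add_scaleR)

lemma closed_psd_multipliers:
  assumes "transpose A0 = A0" "transpose A1 = A1"
  shows "closed (psd_multipliers A0 A1)"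
proof -
  have "psd_multipliers A0 A1
      = {g. 0 \<le> g \<and> (\<forall>v. 0 \<le> v \<bullet> (A0 *v v) + g * (v \<bullet> (A1 *v v)))}"
    using psd_multipliers_iff[OF assms] by blast
  then show ?thesis
    by (auto intro!: closed_Collect_conj closed_Collect_all closed_Collect_le continuous_intros)
qed

lemma is_interval_psd_multipliers:
  assumes "transpose A0 = A0" "transpose A1 = A1"
  shows "is_interval (psd_multipliers A0 A1)"
  unfolding is_interval_1
proof (intro ballI allI impI)
  fix g h k
  assume g: "g \<in> psd_multipliers A0 A1" and h: "h \<in> psd_multipliers A0 A1"
    and k: "g \<le> k \<and> k \<le> h"
  \<comment> \<open>The sign of the slope \<open>b\<close> decides which end of the interval bounds
    the affine function from below.\<close>
  have "0 \<le> a + k * b" if "0 \<le> a + g * b" "0 \<le> a + h * b" for a b :: real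
  proof (cases "0 \<le> b")
    case True
    then show ?thesis using that mult_right_mono[of g k b] k by linarith
  next
    case False
    then show ?thesis using that mult_right_mono_neg[of k h b] k by linarith
  qed
  then show "k \<in> psd_multipliers A0 A1"
    using g h k unfolding psd_multipliers_iff[OF assms] by auto
qed

text \<open>A direction of negative \<open>A1\<close> curvature would turn its affine inequality
  into an upper bound on all multipliers.\<close>

lemma psd_of_unbounded_multipliers:
  assumes sym: "transpose A0 = A0" "transpose A1 = A1"
    and unb: "\<not> bdd_above (psd_multipliers A0 A1)"
  shows "psd A1"
proof -
  have "0 \<le> v \<bullet> (A1 *v v)" for v
  proof (rule ccontr)
    assume "\<not> 0 \<le> v \<bullet> (A1 *v v)"
    then have neg: "v \<bullet> (A1 *v v) < 0" by simp
    have "g \<le> (v \<bullet> (A0 *v v)) / (- (v \<bullet> (A1 *v v)))" if "g \<in> psd_multipliers A0 A1" for g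
    proof -
      have "0 \<le> v \<bullet> (A0 *v v) + g * (v \<bullet> (A1 *v v))"
        using that psd_multipliers_iff[OF sym] by blast
      then show ?thesis using neg by (subst pos_le_divide_eq) auto
    qed
    then show False using unb unfolding bdd_above_def by blast
  qed
  then show ?thesis using sym by (simp add: psd_def)
qed

section \<open>Directions of small curvature at the endpoints\<close>

text \<open>Just left of \<open>m\<close> semidefiniteness fails along some \<open>v\<close>. As it
  holds at \<open>m\<close>, the affine function of the multiplier increases, so \<open>A1\<close>
  has positive curvature along \<open>v\<close>, opposite in sign to a negative
  \<open>q1 x\<close>.\<close>

lemma mem_closure_hull_left_endpoint:
  fixes A0 A1 :: "real^'n^'n"
  assumes sym: "transpose A0 = A0" "transpose A1 = A1"
    and q: "q0 = quad_fun A0 b0 c0" "q1 = quad_fun A1 b1 c1"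
    and m: "m = Inf (psd_multipliers A0 A1)" "m \<in> psd_multipliers A0 A1"
    and x: "q1 x \<le> 0" "aggregate q0 q1 m x \<le> t"
  shows "(x, t) \<in> closure (convex hull (constrained_epigraph q0 q1))"
\<comment> \<open>In both cases \<open>m * q1 x\<close> vanishes, so the point is itself in the
  constrained epigraph.\<close>
proof (cases "q1 x = 0 \<or> m = 0")
  case True
  then have "(x, t) \<in> constrained_epigraph q0 q1"
    using x by (auto simp: constrained_epigraph_def aggregate_def)
  then show ?thesis by (meson closure_subset hull_inc subsetD)
next
  case False
  have "0 \<le> m" using m psd_multipliers_iff[OF sym] by blast
  with False x have mq: "0 < m" "q1 x < 0" by auto
  show ?thesis
  proof (rule mem_closure_hull_constrained_epigraph[OF sym q _ x(2)])
    fix e :: real assume "0 < e"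
    \<comment> \<open>Truncating the step at \<open>m\<close> keeps \<open>g\<close> nonnegative, so
      \<open>g\<close> can fail to be a multiplier only by loss of semidefiniteness.\<close>
    define g where "g = m - min e m"
    have g: "0 \<le> g" "g < m" "m - g \<le> e" using \<open>0 < e\<close> mq by (auto simp: g_def)
    have "bdd_below (psd_multipliers A0 A1)"
      by (auto simp: bdd_below_def psd_multipliers_def)
    then have "g \<notin> psd_multipliers A0 A1"
      using g m cInf_lower[of g "psd_multipliers A0 A1"] by auto
    then obtain v where v: "v \<bullet> (A0 *v v) + g * (v \<bullet> (A1 *v v)) < 0"
      using g psd_multipliers_iff[OF sym] by (meson not_le)
    have m0: "0 \<le> v \<bullet> (A0 *v v) + m * (v \<bullet> (A1 *v v))"
      using m psd_multipliers_iff[OF sym] by blast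
    with v have "0 < (m - g) * (v \<bullet> (A1 *v v))" by (simp add: left_diff_distrib)
    then have pos: "0 < v \<bullet> (A1 *v v)" using g by (simp add: zero_less_mult_iff)
    \<comment> \<open>The value at \<open>g\<close> is negative, so the value at \<open>m\<close> is
      at most the growth over the step.\<close>
    have "v \<bullet> (A0 *v v) + m * (v \<bullet> (A1 *v v)) \<le> (m - g) * (v \<bullet> (A1 *v v))"
      using v by (simp add: left_diff_distrib)
    also have "\<dots> \<le> e * \<bar>v \<bullet> (A1 *v v)\<bar>"
      using g pos by (intro mult_mono) auto
    finally show "\<exists>v. v \<bullet> (A1 *v v) * q1 x < 0 \<and>
        v \<bullet> ((A0 + m *\<^sub>R A1) *v v) \<le> e * \<bar>v \<bullet> (A1 *v v)\<bar>"
      using pos mq by (auto simp: quadratic_form_add_scaleR mult_less_0_iff intro!: exI[of _ v])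
  qed
qed

text \<open>Mirror image of the left endpoint: semidefiniteness fails beyond the supremum, so the
  affine function decreases and \<open>A1\<close> has negative curvature along \<open>v\<close>,
  against a positive \<open>q1 x\<close>.\<close>

lemma mem_closure_hull_right_endpoint:
  fixes A0 A1 :: "real^'n^'n"
  assumes sym: "transpose A0 = A0" "transpose A1 = A1"
    and q: "q0 = quad_fun A0 b0 c0" "q1 = quad_fun A1 b1 c1"
    and bdd: "bdd_above (psd_multipliers A0 A1)"
    and m: "m = Sup (psd_multipliers A0 A1)" "m \<in> psd_multipliers A0 A1"
    and x: "0 < q1 x" "aggregate q0 q1 m x \<le> t"
  shows "(x, t) \<in> closure (convex hull (constrained_epigraph q0 q1))"
proof (rule mem_closure_hull_constrained_epigraph[OF sym q _ x(2)])
  fix e :: real assume e: "0 < e"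
  have "0 \<le> m" using m psd_multipliers_iff[OF sym] by blast
  have "m + e \<notin> psd_multipliers A0 A1"
    using e m cSup_upper[OF _ bdd, of "m + e"] by auto
  then obtain v where v: "v \<bullet> (A0 *v v) + (m + e) * (v \<bullet> (A1 *v v)) < 0"
    using e \<open>0 \<le> m\<close> psd_multipliers_iff[OF sym] by (meson add_nonneg_pos less_imp_le not_le)
  have m0: "0 \<le> v \<bullet> (A0 *v v) + m * (v \<bullet> (A1 *v v))"
    using m psd_multipliers_iff[OF sym] by blast
  with v have "e * (v \<bullet> (A1 *v v)) < 0" by (simp add: distrib_right)
  then have neg: "v \<bullet> (A1 *v v) < 0" using e by (simp add: mult_less_0_iff)
  then have "v \<bullet> (A0 *v v) + m * (v \<bullet> (A1 *v v)) \<le> e * \<bar>v \<bullet> (A1 *v v)\<bar>"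
    using v by (simp add: distrib_right)
  then show "\<exists>v. v \<bullet> (A1 *v v) * q1 x < 0 \<and>
      v \<bullet> ((A0 + m *\<^sub>R A1) *v v) \<le> e * \<bar>v \<bullet> (A1 *v v)\<bar>"
    using neg x by (auto simp: quadratic_form_add_scaleR mult_less_0_iff intro!: exI[of _ v])
qed

section \<open>Closed convex hulls and infima in the two cases\<close>

theorem theorem4:
  fixes A0 A1 :: "real^'n^'n" and b0 b1 :: "real^'n" and c0 c1 :: real
    and q0 q1 :: "real^'n \<Rightarrow> real" and \<Gamma> :: "real set" and \<gamma>m :: real
  assumes sym0: "transpose A0 = A0" and sym1: "transpose A1 = A1"
    and q0: "q0 = quad_fun A0 b0 c0" and q1: "q1 = quad_fun A1 b1 c1"
    and ex: "\<exists>\<gamma>s\<ge>0. psd (A0 + \<gamma>s *\<^sub>R A1)"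
    and \<Gamma>: "\<Gamma> = psd_multipliers A0 A1"
    and \<gamma>m: "\<gamma>m = Inf \<Gamma>"
  shows "(\<Gamma> \<noteq> {} \<and> closed \<Gamma> \<and> is_interval \<Gamma>) \<and>
    (bdd_above \<Gamma> \<longrightarrow>
      (\<forall>\<gamma>p. \<gamma>p = Sup \<Gamma> \<longrightarrow>
        closure (convex hull (constrained_epigraph q0 q1))
          = aggregate_epigraph q0 q1 \<gamma>m \<inter> aggregate_epigraph q0 q1 \<gamma>p \<and>
        (INF x\<in>{x. q1 x \<le> 0}. ereal (q0 x))
          = (INF x. ereal (max (aggregate q0 q1 \<gamma>m x) (aggregate q0 q1 \<gamma>p x))))) \<and>
    (\<not> bdd_above \<Gamma> \<longrightarrow>
      convex_on UNIV q1 \<and>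
      closure (convex hull (constrained_epigraph q0 q1))
        = aggregate_epigraph q0 q1 \<gamma>m \<inter> {(x, t). q1 x \<le> 0} \<and>
      (INF x\<in>{x. q1 x \<le> 0}. ereal (q0 x))
        = (INF x\<in>{x. q1 x \<le> 0}. ereal (aggregate q0 q1 \<gamma>m x)))"
proof (intro conjI impI allI)
  let ?S = "constrained_epigraph q0 q1"
  let ?agg = "aggregate q0 q1"
  show ne: "\<Gamma> \<noteq> {}"
    using ex by (auto simp: \<Gamma> psd_multipliers_def)
  show cl: "closed \<Gamma>"
    unfolding \<Gamma> by (rule closed_psd_multipliers[OF sym0 sym1])
  show "is_interval \<Gamma>"
    unfolding \<Gamma> by (rule is_interval_psd_multipliers[OF sym0 sym1])
  have "bdd_below \<Gamma>"
    by (auto simp: \<Gamma> bdd_below_def psd_multipliers_def)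
  then have m: "\<gamma>m \<in> \<Gamma>"
    unfolding \<gamma>m by (intro closed_contains_Inf ne cl)
  have sub: "closure (convex hull ?S) \<subseteq> aggregate_epigraph q0 q1 g" if "g \<in> \<Gamma>" for g
    unfolding q0 q1 using that
    by (intro closure_hull_constrained_epigraph_subset) (auto simp: \<Gamma> psd_multipliers_def)
  have left: "(x, t) \<in> closure (convex hull ?S)" if "q1 x \<le> 0" "?agg \<gamma>m x \<le> t" for x t
    using mem_closure_hull_left_endpoint[OF sym0 sym1 q0 q1 _ _ that] m \<gamma>m \<Gamma> by blast
  \<comment> \<open>Aggregation relaxes the problem; this is the easy half of both equalities of
    infima.\<close>
  have agg_le: "?agg g x \<le> q0 x" if "g \<in> \<Gamma>" "q1 x \<le> 0" for g x
    using that by (auto simp: \<Gamma> psd_multipliers_def aggregate_def mult_nonneg_nonpos)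
  {
    fix \<gamma>p assume bdd: "bdd_above \<Gamma>" and \<gamma>p: "\<gamma>p = Sup \<Gamma>"
    have p: "\<gamma>p \<in> \<Gamma>"
      unfolding \<gamma>p by (intro closed_contains_Sup ne cl bdd)
    \<comment> \<open>The sign of \<open>q1 x\<close> decides which endpoint of
      \<open>\<Gamma>\<close> supplies the directions.\<close>
    have hull: "(x, t) \<in> closure (convex hull ?S)" if "?agg \<gamma>m x \<le> t" "?agg \<gamma>p x \<le> t" for x t
    proof (cases "q1 x \<le> 0")
      case True
      then show ?thesis using left that by blast
    next
      case False
      then show ?thesis
        using mem_closure_hull_right_endpoint[OF sym0 sym1 q0 q1 _ _ _ _ that(2)] bdd p \<gamma>p \<Gamma>
        by simp
    qed
    show "closure (convex hull ?S) = aggregate_epigraph q0 q1 \<gamma>m \<inter> aggregate_epigraph q0 q1 \<gamma>p"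
    proof
      show "closure (convex hull ?S)
          \<subseteq> aggregate_epigraph q0 q1 \<gamma>m \<inter> aggregate_epigraph q0 q1 \<gamma>p"
        using sub m p by blast
      show "aggregate_epigraph q0 q1 \<gamma>m \<inter> aggregate_epigraph q0 q1 \<gamma>p
          \<subseteq> closure (convex hull ?S)"
        using hull by (auto simp: aggregate_epigraph_def)
    qed
    show "(INF x\<in>{x. q1 x \<le> 0}. ereal (q0 x)) = (INF x. ereal (max (?agg \<gamma>m x) (?agg \<gamma>p x)))"
    proof (rule antisym)
      \<comment> \<open>The point over \<open>x\<close> at the height of the maximum lies in the
        closed hull, where no height is below the constrained infimum.\<close>
      show "(INF x\<in>{x. q1 x \<le> 0}. ereal (q0 x)) \<le> (INF x. ereal (max (?agg \<gamma>m x) (?agg \<gamma>p x)))"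
        by (rule INF_greatest, rule INF_le_closure_hull_constrained_epigraph)
          (rule hull[OF max.cobounded1 max.cobounded2])
      show "(INF x. ereal (max (?agg \<gamma>m x) (?agg \<gamma>p x))) \<le> (INF x\<in>{x. q1 x \<le> 0}. ereal (q0 x))"
        using agg_le m p by (intro INF_mono) auto
    qed
  }
  {
    assume unb: "\<not> bdd_above \<Gamma>"
    then have "psd A1"
      using psd_of_unbounded_multipliers[OF sym0 sym1] \<Gamma> by simp
    then show conv: "convex_on UNIV q1"
      unfolding q1 by (rule convex_on_quad_fun)
    let ?F = "{(x, t). q1 x \<le> 0} :: ((real^'n) \<times> real) set"
    have F: "?F = {x. q1 x \<le> 0} \<times> UNIV" by auto
    have "convex {x. q1 x \<le> 0}"
      unfolding convex_def mem_Collect_eq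
      by (intro ballI allI impI order_trans[OF convex_lower[OF conv]]) auto
    then have "convex ?F"
      unfolding F by (intro convex_Times convex_UNIV)
    moreover have "closed ?F"
      unfolding F unfolding q1
      by (intro closed_Times closed_UNIV closed_Collect_le continuous_intros)
    ultimately have subF: "closure (convex hull ?S) \<subseteq> ?F"
      by (intro closure_minimal hull_minimal) (auto simp: constrained_epigraph_def)
    show "closure (convex hull ?S) = aggregate_epigraph q0 q1 \<gamma>m \<inter> ?F"
    proof
      show "closure (convex hull ?S) \<subseteq> aggregate_epigraph q0 q1 \<gamma>m \<inter> ?F"
        using sub[OF m] subF by blast
      \<comment> \<open>Membership in \<open>?F\<close> gives \<open>q1 x \<le> 0\<close>, so the
        left endpoint reaches every such point.\<close>
      show "aggregate_epigraph q0 q1 \<gamma>m \<inter> ?F \<subseteq> closure (convex hull ?S)"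
        using left by (auto simp: aggregate_epigraph_def)
    qed
    show "(INF x\<in>{x. q1 x \<le> 0}. ereal (q0 x)) = (INF x\<in>{x. q1 x \<le> 0}. ereal (?agg \<gamma>m x))"
    proof (rule antisym)
      show "(INF x\<in>{x. q1 x \<le> 0}. ereal (q0 x)) \<le> (INF x\<in>{x. q1 x \<le> 0}. ereal (?agg \<gamma>m x))"
        by (rule INF_greatest, rule INF_le_closure_hull_constrained_epigraph)
          (auto intro: left[OF _ order_refl])
      show "(INF x\<in>{x. q1 x \<le> 0}. ereal (?agg \<gamma>m x)) \<le> (INF x\<in>{x. q1 x \<le> 0}. ereal (q0 x))"
        using agg_le m by (intro INF_mono) auto
    qed
  }
qed

end
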